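(* The Homotopy Perturbation Method (HPM) is a special case of the Homotopy Analysis Method (HAM) when the auxiliary linear operator, convergence-control parameter and auxiliary function are fixed to $\mathcal{L}_{\mathrm{opt}} = L$, $\hbar = -1$, $H(\mathbf{r}) = 1$. Precisely: let $\mathcal{F}(u) = L(u) + N(u) - s(\mathbf{r})$ with $L$ linear, $N$ nonlinear and $s$ a known source term, and let $u_0$ be the initial guess. With the choices $\mathcal{L}_{\mathrm{opt}} = L$, $\hbar = -1$, $H(\mathbf{r}) = 1$, for every homotopy parameter $p \in [0,1]$ the HAM zeroth-order deformation equation $$(1-p)\,\mathcal{L}_{\mathrm{opt}}[\varphi - u_0] = p\,\hbar\, H(\mathbf{r})\,\mathcal{F}(\varphi)$$ for the unknown $\varphi$ is identical to the HPM homotopy equation $$L(\varphi) - L(u_0) + p\,L(u_0) + p\,[N(\varphi) - s(\mathbf{r})] = 0 .$$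
   Context: Let $\Omega \subset \mathbb{R}^n$ be a domain with independent variable $\mathbf{r}$, and let $\mathbb{X}, \mathbb{Y}$ be Banach spaces of (sufficiently smooth) functions on $\Omega$. The nonlinear system is $\mathcal{F}(u) = L(u) + N(u) - s(\mathbf{r}) = 0$ for an unknown $u \in \mathbb{X}$, where $\mathcal{F}: \mathbb{X} \to \mathbb{Y}$, $L$ is a linear differential operator, $N$ is a nonlinear differential operator and $s$ is a known real-analytic function on $\Omega$. The Homotopy Analysis Method (HAM) is based on the zeroth-order deformation equation $(1-p)\mathcal{L}_{\mathrm{opt}}[\varphi - u_0] = p\,\hbar\,H(\mathbf{r})\,\mathcal{F}(\varphi)$, where $p \in [0,1]$ is the homotopy parameter, $\mathcal{L}_{\mathrm{opt}}: \mathbb{X} \to \mathbb{Y}$ is an auxiliary linear operator, $\hbar \neq 0$ is a real constant (the convergence-control parameter), $H$ is a nonzero real-analytic function on $\Omega$ (the auxiliary function), and $u_0 \in \mathbb{X}$ is the initial guess. The Homotopy Perturbation Method (HPM) is based on the homotopy equation $L(\omega) - L(u_0) + p\,L(u_0) + p\,[N(\omega) - s(\mathbf{r})] = 0$, where $p \in [0,1]$ and $u_0$ is the initial guess. *)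

theory Defs
  imports "HOL-Analysis.Analysis"
begin

definition partial_deriv :: "'n::finite \<Rightarrow> (real ^ 'n \<Rightarrow> real) \<Rightarrow> real ^ 'n \<Rightarrow> real" where
  "partial_deriv i f x = deriv (\<lambda>t. f (x + t *\<^sub>R axis i 1)) 0"

primrec iter_partial :: "'n::finite list \<Rightarrow> (real ^ 'n \<Rightarrow> real) \<Rightarrow> real ^ 'n \<Rightarrow> real" where
  "iter_partial [] f = f"
| "iter_partial (i # is) f = partial_deriv i (iter_partial is f)"

text \<open>The class C^k on an open set.\<close>

primrec Ck_on :: "nat \<Rightarrow> (real ^ 'n::finite \<Rightarrow> real) \<Rightarrow> (real ^ 'n) set \<Rightarrow> bool" where
  "Ck_on 0 f \<Omega> \<longleftrightarrow> continuous_on \<Omega> f"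
| "Ck_on (Suc k) f \<Omega> \<longleftrightarrow>
     (\<forall>x\<in>\<Omega>. f differentiable (at x)) \<and> (\<forall>i. Ck_on k (partial_deriv i f) \<Omega>)"

text \<open>Near every point the function is the sum of an (absolutely convergent) power series
  in several variables, indexed by multi-indices.\<close>

definition real_analytic_on :: "(real ^ 'n::finite \<Rightarrow> real) \<Rightarrow> (real ^ 'n) set \<Rightarrow> bool" where
  "real_analytic_on f \<Omega> \<longleftrightarrow>
     (\<forall>a\<in>\<Omega>. \<exists>\<epsilon>>0. \<exists>c :: ('n \<Rightarrow> nat) \<Rightarrow> real. \<forall>x\<in>ball a \<epsilon>.
        ((\<lambda>\<alpha>. c \<alpha> * (\<Prod>i\<in>UNIV. (x $ i - a $ i) ^ \<alpha> i)) has_sum f x) UNIV)"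

text \<open>A Banach space of functions on \<open>\<Omega>\<close> is a Banach space \<open>'x\<close> together with the map \<open>ev\<close>
  taking an element to the function it is. Only the values on \<open>\<Omega>\<close> are meaningful: there the
  vector space operations are the pointwise ones, and they determine the element.
  The functions are required to be of class C^m.\<close>

definition function_space ::
    "(real ^ 'n::finite) set \<Rightarrow> nat \<Rightarrow> ('x::banach \<Rightarrow> real ^ 'n \<Rightarrow> real) \<Rightarrow> bool" where
  "function_space \<Omega> m ev \<longleftrightarrow>
     (\<forall>r\<in>\<Omega>. linear (\<lambda>u. ev u r)) \<and>
     (\<forall>u v. (\<forall>r\<in>\<Omega>. ev u r = ev v r) \<longrightarrow> u = v) \<and>
     (\<forall>u. Ck_on m (ev u) \<Omega>)"

text \<open>Differential operators of order at most \<open>k\<close>. Derivatives are indexed by lists of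
  directions rather than by multi-indices; for functions of class C^k the order of
  differentiation is irrelevant, so this gives the same operators.\<close>

definition linear_differential_operator ::
    "(real ^ 'n::finite) set \<Rightarrow> ('x::banach \<Rightarrow> real ^ 'n \<Rightarrow> real) \<Rightarrow> ('y::banach \<Rightarrow> real ^ 'n \<Rightarrow> real) \<Rightarrow>
     nat \<Rightarrow> ('x \<Rightarrow> 'y) \<Rightarrow> bool" where
  "linear_differential_operator \<Omega> evX evY k L \<longleftrightarrow>
     linear L \<and>
     (\<exists>a :: 'n list \<Rightarrow> real ^ 'n \<Rightarrow> real. \<forall>u. \<forall>r\<in>\<Omega>.
        evY (L u) r = (\<Sum>is | length is \<le> k. a is r * iter_partial is (evX u) r))"

definition differential_operator ::
    "(real ^ 'n::finite) set \<Rightarrow> ('x::banach \<Rightarrow> real ^ 'n \<Rightarrow> real) \<Rightarrow> ('y::banach \<Rightarrow> real ^ 'n \<Rightarrow> real) \<Rightarrow>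
     nat \<Rightarrow> ('x \<Rightarrow> 'y) \<Rightarrow> bool" where
  "differential_operator \<Omega> evX evY k N \<longleftrightarrow>
     (\<exists>G :: real ^ 'n \<Rightarrow> ('n list \<Rightarrow> real) \<Rightarrow> real. \<forall>u. \<forall>r\<in>\<Omega>.
        evY (N u) r = G r (\<lambda>is. if length is \<le> k then iter_partial is (evX u) r else 0))"

definition nonlinear_differential_operator ::
    "(real ^ 'n::finite) set \<Rightarrow> ('x::banach \<Rightarrow> real ^ 'n \<Rightarrow> real) \<Rightarrow> ('y::banach \<Rightarrow> real ^ 'n \<Rightarrow> real) \<Rightarrow>
     nat \<Rightarrow> ('x \<Rightarrow> 'y) \<Rightarrow> bool" where
  "nonlinear_differential_operator \<Omega> evX evY k N \<longleftrightarrow>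
     differential_operator \<Omega> evX evY k N \<and> \<not> linear N"

definition system_op :: "('x::banach \<Rightarrow> 'y::banach) \<Rightarrow> ('x \<Rightarrow> 'y) \<Rightarrow> 'y \<Rightarrow> 'x \<Rightarrow> 'y" where
  "system_op L N s u = L u + N u - s"

text \<open>The admissible choices of auxiliary linear operator, convergence-control parameter and
  auxiliary function in the homotopy analysis method. A nonzero function is one that does
  not vanish identically on \<open>\<Omega>\<close>.\<close>

definition ham_auxiliary ::
    "(real ^ 'n::finite) set \<Rightarrow> ('x::banach \<Rightarrow> 'y::banach) \<Rightarrow> real \<Rightarrow> (real ^ 'n \<Rightarrow> real) \<Rightarrow> bool" where
  "ham_auxiliary \<Omega> Lopt hbar H \<longleftrightarrow>
     linear Lopt \<and> hbar \<noteq> 0 \<and> real_analytic_on H \<Omega> \<and> (\<exists>r\<in>\<Omega>. H r \<noteq> 0)"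

text \<open>The two sides of the zeroth-order deformation equation are functions on \<open>\<Omega>\<close>; the right
  one need not belong to the space \<open>'y\<close>, since that space need not be closed under
  multiplication by \<open>H\<close>.\<close>

definition ham_lhs ::
    "('y::banach \<Rightarrow> real ^ 'n::finite \<Rightarrow> real) \<Rightarrow> ('x::banach \<Rightarrow> 'y) \<Rightarrow> 'x \<Rightarrow> real \<Rightarrow> 'x \<Rightarrow>
     real ^ 'n \<Rightarrow> real" where
  "ham_lhs evY Lopt u0 p \<phi> r = (1 - p) * evY (Lopt (\<phi> - u0)) r"

definition ham_rhs ::
    "('y::banach \<Rightarrow> real ^ 'n::finite \<Rightarrow> real) \<Rightarrow> real \<Rightarrow> (real ^ 'n \<Rightarrow> real) \<Rightarrow> ('x::banach \<Rightarrow> 'y) \<Rightarrow>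
     real \<Rightarrow> 'x \<Rightarrow> real ^ 'n \<Rightarrow> real" where
  "ham_rhs evY hbar H F p \<phi> r = p * hbar * H r * evY (F \<phi>) r"

definition ham_equation ::
    "(real ^ 'n::finite) set \<Rightarrow> ('y::banach \<Rightarrow> real ^ 'n \<Rightarrow> real) \<Rightarrow> ('x::banach \<Rightarrow> 'y) \<Rightarrow> real \<Rightarrow>
     (real ^ 'n \<Rightarrow> real) \<Rightarrow> ('x \<Rightarrow> 'y) \<Rightarrow> 'x \<Rightarrow> real \<Rightarrow> 'x \<Rightarrow> bool" where
  "ham_equation \<Omega> evY Lopt hbar H F u0 p \<phi> \<longleftrightarrow>
     (\<forall>r\<in>\<Omega>. ham_lhs evY Lopt u0 p \<phi> r = ham_rhs evY hbar H F p \<phi> r)"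

definition hpm_lhs ::
    "('x::banach \<Rightarrow> 'y::banach) \<Rightarrow> ('x \<Rightarrow> 'y) \<Rightarrow> 'y \<Rightarrow> 'x \<Rightarrow> real \<Rightarrow> 'x \<Rightarrow> 'y" where
  "hpm_lhs L N s u0 p \<omega> = L \<omega> - L u0 + p *\<^sub>R L u0 + p *\<^sub>R (N \<omega> - s)"

definition hpm_equation ::
    "('x::banach \<Rightarrow> 'y::banach) \<Rightarrow> ('x \<Rightarrow> 'y) \<Rightarrow> 'y \<Rightarrow> 'x \<Rightarrow> real \<Rightarrow> 'x \<Rightarrow> bool" where
  "hpm_equation L N s u0 p \<omega> \<longleftrightarrow> hpm_lhs L N s u0 p \<omega> = 0"

end

theory Submission
  imports Defs
begin

text \<open>With \<open>Lopt = L\<close>, \<open>hbar = -1\<close> and \<open>H = 1\<close>, the two methods have the same residual,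
  not only the same solutions. By linearity of \<open>L\<close>,
  \<open>(1 - p) L(\<phi> - u0) + p (L \<phi> + N \<phi> - s) = L \<phi> - L u0 + p L u0 + p (N \<phi> - s)\<close>:
  the terms \<open>- p L \<phi>\<close> of the deformation and \<open>p L \<phi>\<close> of the system cancel. The left side is the
  difference of the two sides of the deformation equation, the right side is the operator of
  the homotopy perturbation method (\<open>residual_eq_hpm\<close>).

  The deformation equation is stated pointwise on \<open>\<Omega>\<close>, the other one in the space \<open>'y\<close>. Pointwise
  evaluation is linear and injective, so an element of \<open>'y\<close> is zero exactly when its values on
  \<open>\<Omega>\<close> are, and the equality of residuals makes the equations equivalent. The choice of
  auxiliary data is admissible because a constant is its own power series and \<open>1\<close> does not vanish
  on the nonempty set \<open>\<Omega>\<close>.\<close>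

lemma real_analytic_on_const: "real_analytic_on (\<lambda>_ :: real ^ 'n::finite. b) \<Omega>"
  unfolding real_analytic_on_def
proof
  fix a :: "real ^ 'n"
  \<comment> \<open>Only the coefficient of the zero multi-index survives.\<close>
  define c :: "('n \<Rightarrow> nat) \<Rightarrow> real" where "c = (\<lambda>\<alpha>. if \<alpha> = (\<lambda>_. 0) then b else 0)"
  have "((\<lambda>\<alpha>. c \<alpha> * (\<Prod>i\<in>UNIV. (x $ i - a $ i) ^ \<alpha> i)) has_sum b) UNIV" for x :: "real ^ 'n"
  proof -
    let ?f = "\<lambda>\<alpha>. c \<alpha> * (\<Prod>i\<in>UNIV. (x $ i - a $ i) ^ \<alpha> i)"
    have "(?f has_sum b) {\<lambda>_. 0}"
      using has_sum_finite[of "{\<lambda>_. 0}" ?f] by (simp add: c_def)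
    moreover have "(?f has_sum b) {\<lambda>_. 0} \<longleftrightarrow> (?f has_sum b) UNIV"
      by (rule has_sum_cong_neutral) (auto simp: c_def)
    ultimately show ?thesis by simp
  qed
  then show "\<exists>\<epsilon>>0. \<exists>c :: ('n \<Rightarrow> nat) \<Rightarrow> real. \<forall>x\<in>ball a \<epsilon>.
      ((\<lambda>\<alpha>. c \<alpha> * (\<Prod>i\<in>UNIV. (x $ i - a $ i) ^ \<alpha> i)) has_sum b) UNIV"
    by (intro exI[of _ 1] exI[of _ c] conjI ballI) simp_all
qed

lemma function_space_linear_eval:
  "function_space \<Omega> m ev \<Longrightarrow> r \<in> \<Omega> \<Longrightarrow> linear (\<lambda>u. ev u r)"
  by (simp add: function_space_def)

text \<open>Injectivity of evaluation turns an equation between functions on \<open>\<Omega>\<close> into one between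
  elements of the Banach space.\<close>

lemma function_space_eq_0_iff:
  assumes "function_space \<Omega> m ev"
  shows "u = 0 \<longleftrightarrow> (\<forall>r\<in>\<Omega>. ev u r = 0)"
proof -
  have "ev 0 r = 0" if "r \<in> \<Omega>" for r
    using linear_0[OF function_space_linear_eval[OF assms that]] .
  moreover have "(\<forall>r\<in>\<Omega>. ev u r = ev 0 r) \<Longrightarrow> u = 0"
    using assms unfolding function_space_def by blast
  ultimately show ?thesis by auto
qed

text \<open>The cancellation behind the theorem happens in the target space: evaluation at
  points of \<open>\<Omega>\<close> enters only afterwards.\<close>

lemma deformation_eq_hpm_lhs:
  assumes "linear L"
  shows "(1 - p) *\<^sub>R L (\<phi> - u0) + p *\<^sub>R system_op L N s \<phi> = hpm_lhs L N s u0 p \<phi>"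
  by (simp add: system_op_def hpm_lhs_def linear_diff[OF assms] algebra_simps)

lemma residual_eq_hpm:
  assumes "linear L" and "linear (\<lambda>v. evY v r)"
  shows "ham_lhs evY L u0 p \<phi> r - ham_rhs evY (-1) (\<lambda>r. 1) (system_op L N s) p \<phi> r =
    evY (hpm_lhs L N s u0 p \<phi>) r"
  unfolding deformation_eq_hpm_lhs[OF assms(1), symmetric]
  by (simp add: ham_lhs_def ham_rhs_def linear_add[OF assms(2)] linear_scale[OF assms(2)])

theorem theorem5p1:
  fixes \<Omega> :: "(real ^ 'n::finite) set"
    and evX :: "'x::banach \<Rightarrow> real ^ 'n \<Rightarrow> real"
    and evY :: "'y::banach \<Rightarrow> real ^ 'n \<Rightarrow> real"
    and L N :: "'x \<Rightarrow> 'y" and s :: 'y and u0 :: 'x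
    and mX mY kL kN :: nat
  assumes "open \<Omega>" and "connected \<Omega>" and "\<Omega> \<noteq> {}"
    and "function_space \<Omega> mX evX" and "function_space \<Omega> mY evY"
    and "kL \<le> mX" and "linear_differential_operator \<Omega> evX evY kL L"
    and "kN \<le> mX" and "nonlinear_differential_operator \<Omega> evX evY kN N"
    and "real_analytic_on (evY s) \<Omega>"
  shows "ham_auxiliary \<Omega> L (-1) (\<lambda>r. 1) \<and>
    (\<forall>p\<in>{0..1}. \<forall>\<phi>.
       (ham_equation \<Omega> evY L (-1) (\<lambda>r. 1) (system_op L N s) u0 p \<phi> \<longleftrightarrow>
        hpm_equation L N s u0 p \<phi>) \<and>
       (\<forall>r\<in>\<Omega>. ham_lhs evY L u0 p \<phi> r - ham_rhs evY (-1) (\<lambda>r. 1) (system_op L N s) p \<phi> r =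
               evY (hpm_lhs L N s u0 p \<phi>) r))"
proof -
  have L: "linear L"
    using assms(7) by (simp add: linear_differential_operator_def)
  have residual: "ham_lhs evY L u0 p \<phi> r - ham_rhs evY (-1) (\<lambda>r. 1) (system_op L N s) p \<phi> r =
      evY (hpm_lhs L N s u0 p \<phi>) r" if "r \<in> \<Omega>" for p \<phi> r
    using L function_space_linear_eval[OF assms(5) that] by (rule residual_eq_hpm)
  have "ham_equation \<Omega> evY L (-1) (\<lambda>r. 1) (system_op L N s) u0 p \<phi> \<longleftrightarrow>
      hpm_equation L N s u0 p \<phi>" for p \<phi>
    unfolding ham_equation_def hpm_equation_def function_space_eq_0_iff[OF assms(5)]
    by (simp flip: residual)
  moreover have "ham_auxiliary \<Omega> L (-1) (\<lambda>r. 1)"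
    using L assms(3) by (auto simp: ham_auxiliary_def real_analytic_on_const)
  ultimately show ?thesis
    using residual by blast
qed

end
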